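(* Let $R$ and $S$ be rings, let $W$ be an $(R,S)$-bimodule, and let $P$ be a projective left $R$-module. Then the left $R$-versor $P\backslash_R W: P\times\mathrm{Hom}_R(P,W)\to W$, $(x,\tau)\mapsto x\tau$, is a projective object of the adjoint category $\mathrm{Adj}(W)$.
   Context: Homomorphisms of left $R$-modules are written on the right of their arguments ($u\mu$), homomorphisms of right $S$-modules on the left ($\nu v$). For a left $R$-module $U$, a right $S$-module $V$ and an $(R,S)$-bimodule $W$, an $(R,S)$-bimap is a function $B:U\times V\to W$, written $uBv$, that is additive in each variable and satisfies $(ru)Bv=r(uBv)$ and $uB(vs)=(uBv)s$ for all $r\in R$, $s\in S$, $u\in U$, $v\in V$. The adjoint category $\mathrm{Adj}(W)$ (with the $(R,S)$-bimodule $W$ fixed) has as objects all $(R,S)$-bimaps $B:U\times V\to W$ into $W$. A morphism from $B:U\times V\to W$ to $C:U'\times V'\to W$ is a pair $(\overleftarrow{\mu},\overrightarrow{\mu})$ with $\overleftarrow{\mu}\in\mathrm{Hom}_R(U,U')$ and $\overrightarrow{\mu}\in\mathrm{Hom}_S(V',V)$ such that $(u\overleftarrow{\mu})Cv'=uB(\overrightarrow{\mu}v')$ for all $u\in U$, $v'\in V'$. The composite of $(\overleftarrow{\mu},\overrightarrow{\mu}):B\to C$ followed by $(\overleftarrow{\nu},\overrightarrow{\nu}):C\to D$ is the pair consisting of $u\mapsto (u\overleftarrow{\mu})\overleftarrow{\nu}$ and $v\mapsto \overrightarrow{\mu}(\overrightarrow{\nu}v)$. Left versor: for a left $R$-module $U$,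 the left $R$-versor is an $(R,S)$-bimap $U\times (U\backslash_R W)\to W$ through which every $(R,S)$-bimap $B:U\times V\to W$ factors as $(u,v)\mapsto (u,\sigma^B v)$ followed by the versor for a unique $S$-homomorphism $\sigma^B:V\to U\backslash_R W$. It is unique up to canonical isomorphism and is realized by $U\backslash_R W=\mathrm{Hom}_R(U,W)$ (a right $S$-module via $u(\tau s)=(u\tau)s$) with $(u,\tau)\mapsto u\tau$. The symbol $U\backslash_R W$ is used for this bimap as well as for the right $S$-module. *)

theory Defs
  imports "HOL-Algebra.Module"
begin

section \<open>Modules over possibly noncommutative rings\<close>

text \<open>
  Rings are associative and unital and modules are unital. The locale \<open>module\<close> of HOL-Algebra
  requires a commutative ring, so only its record type is reused here. As there, the fields
  \<open>mult\<close> and \<open>one\<close> that the record inherits from rings carry no meaning for a module.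
\<close>

locale left_module = R?: ring R + M?: abelian_group M
  for R (structure) and M (structure) +
  assumes smult_closed [simp, intro]:
      "\<lbrakk>r \<in> carrier R; x \<in> carrier M\<rbrakk> \<Longrightarrow> r \<odot>\<^bsub>M\<^esub> x \<in> carrier M"
    and smult_l_distr:
      "\<lbrakk>r \<in> carrier R; r' \<in> carrier R; x \<in> carrier M\<rbrakk> \<Longrightarrow>
        (r \<oplus>\<^bsub>R\<^esub> r') \<odot>\<^bsub>M\<^esub> x = r \<odot>\<^bsub>M\<^esub> x \<oplus>\<^bsub>M\<^esub> r' \<odot>\<^bsub>M\<^esub> x"
    and smult_r_distr:
      "\<lbrakk>r \<in> carrier R; x \<in> carrier M; y \<in> carrier M\<rbrakk> \<Longrightarrow>
        r \<odot>\<^bsub>M\<^esub> (x \<oplus>\<^bsub>M\<^esub> y) = r \<odot>\<^bsub>M\<^esub> x \<oplus>\<^bsub>M\<^esub> r \<odot>\<^bsub>M\<^esub> y"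
    and smult_assoc:
      "\<lbrakk>r \<in> carrier R; r' \<in> carrier R; x \<in> carrier M\<rbrakk> \<Longrightarrow>
        (r \<otimes>\<^bsub>R\<^esub> r') \<odot>\<^bsub>M\<^esub> x = r \<odot>\<^bsub>M\<^esub> (r' \<odot>\<^bsub>M\<^esub> x)"
    and smult_one:
      "x \<in> carrier M \<Longrightarrow> \<one>\<^bsub>R\<^esub> \<odot>\<^bsub>M\<^esub> x = x"

record ('s, 'v) right_module = "'v ring" +
  rsmult :: "['v, 's] \<Rightarrow> 'v" (infixl "\<bullet>\<index>" 70)

locale right_module = S?: ring S + M?: abelian_group M
  for S (structure) and M (structure) +
  assumes rsmult_closed [simp, intro]:
      "\<lbrakk>x \<in> carrier M; s \<in> carrier S\<rbrakk> \<Longrightarrow> x \<bullet>\<^bsub>M\<^esub> s \<in> carrier M"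
    and rsmult_r_distr:
      "\<lbrakk>x \<in> carrier M; s \<in> carrier S; s' \<in> carrier S\<rbrakk> \<Longrightarrow>
        x \<bullet>\<^bsub>M\<^esub> (s \<oplus>\<^bsub>S\<^esub> s') = x \<bullet>\<^bsub>M\<^esub> s \<oplus>\<^bsub>M\<^esub> x \<bullet>\<^bsub>M\<^esub> s'"
    and rsmult_l_distr:
      "\<lbrakk>x \<in> carrier M; y \<in> carrier M; s \<in> carrier S\<rbrakk> \<Longrightarrow>
        (x \<oplus>\<^bsub>M\<^esub> y) \<bullet>\<^bsub>M\<^esub> s = x \<bullet>\<^bsub>M\<^esub> s \<oplus>\<^bsub>M\<^esub> y \<bullet>\<^bsub>M\<^esub> s"
    and rsmult_assoc:
      "\<lbrakk>x \<in> carrier M; s \<in> carrier S; s' \<in> carrier S\<rbrakk> \<Longrightarrow>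
        x \<bullet>\<^bsub>M\<^esub> (s \<otimes>\<^bsub>S\<^esub> s') = (x \<bullet>\<^bsub>M\<^esub> s) \<bullet>\<^bsub>M\<^esub> s'"
    and rsmult_one:
      "x \<in> carrier M \<Longrightarrow> x \<bullet>\<^bsub>M\<^esub> \<one>\<^bsub>S\<^esub> = x"

record ('r, 's, 'w) bimodule = "('r, 'w) module" +
  ract :: "['w, 's] \<Rightarrow> 'w"

definition right_part :: "('r, 's, 'w) bimodule \<Rightarrow> ('s, 'w) right_module" where
  "right_part W = \<lparr>carrier = carrier W, monoid.mult = monoid.mult W, one = one W,
     zero = zero W, add = add W, rsmult = ract W\<rparr>"

locale bimodule = left_module R W + right: right_module S "right_part W"
  for R (structure) and S (structure) and W (structure) +
  assumes smult_ract:
    "\<lbrakk>r \<in> carrier R; w \<in> carrier W; s \<in> carrier S\<rbrakk> \<Longrightarrow>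
      ract W (r \<odot>\<^bsub>W\<^esub> w) s = r \<odot>\<^bsub>W\<^esub> ract W w s"

text \<open>
  Homomorphisms are extensional functions on the carrier, so that equality of functions is
  equality of homomorphisms. All homomorphisms are applied in prefix form, \<open>\<mu> u\<close> for \<open>u\<mu>\<close>.
\<close>

definition lhom ::
  "('r, 'm) ring_scheme \<Rightarrow> ('r, 'a, 'p) module_scheme \<Rightarrow> ('r, 'b, 'q) module_scheme \<Rightarrow> ('a \<Rightarrow> 'b) set"
  where "lhom R M N = {f \<in> carrier M \<rightarrow>\<^sub>E carrier N.
    (\<forall>x\<in>carrier M. \<forall>y\<in>carrier M. f (x \<oplus>\<^bsub>M\<^esub> y) = f x \<oplus>\<^bsub>N\<^esub> f y) \<and>
    (\<forall>r\<in>carrier R. \<forall>x\<in>carrier M. f (r \<odot>\<^bsub>M\<^esub> x) = r \<odot>\<^bsub>N\<^esub> f x)}"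

definition rhom ::
  "('s, 'm) ring_scheme \<Rightarrow> ('s, 'a) right_module \<Rightarrow> ('s, 'b) right_module \<Rightarrow> ('a \<Rightarrow> 'b) set"
  where "rhom S M N = {f \<in> carrier M \<rightarrow>\<^sub>E carrier N.
    (\<forall>x\<in>carrier M. \<forall>y\<in>carrier M. f (x \<oplus>\<^bsub>M\<^esub> y) = f x \<oplus>\<^bsub>N\<^esub> f y) \<and>
    (\<forall>s\<in>carrier S. \<forall>x\<in>carrier M. f (x \<bullet>\<^bsub>M\<^esub> s) = f x \<bullet>\<^bsub>N\<^esub> s)}"

text \<open>
  Projectivity is the lifting property against surjective homomorphisms \<open>M \<rightarrow> N\<close>. HOL cannot
  quantify over the types of the elements of \<open>M\<close> and \<open>N\<close>, so one type is fixed for them. It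
  contains a copy of the free module on the carrier of \<open>P\<close> (finitely supported functions
  \<open>'u \<Rightarrow> 'r\<close>) and a copy of \<open>P\<close>; lifting the identity of \<open>P\<close> against the canonical surjection
  shows that \<open>P\<close> is a direct summand of a free module. Nothing is therefore lost compared
  with modules \<open>M\<close> and \<open>N\<close> over arbitrary types.
\<close>

definition projective_module :: "('r, 'm) ring_scheme \<Rightarrow> ('r, 'u) module \<Rightarrow> bool" where
  "projective_module R P \<longleftrightarrow> left_module R P \<and>
    (\<forall>(M :: ('r, ('u \<Rightarrow> 'r) + 'u) module) (N :: ('r, ('u \<Rightarrow> 'r) + 'u) module).
      left_module R M \<longrightarrow> left_module R N \<longrightarrow>
      (\<forall>g\<in>lhom R M N. g ` carrier M = carrier N \<longrightarrow>
        (\<forall>f\<in>lhom R P N. \<exists>h\<in>lhom R P M. compose (carrier P) g h = f)))"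

section \<open>Categories and projective objects\<close>

text \<open>
  Arrows do not carry their source and target; these are arguments of the composition.
  \<open>comp C A B D f g\<close> is \<open>f : A \<rightarrow> B\<close> followed by \<open>g : B \<rightarrow> D\<close>.
\<close>

record ('o, 'a) category =
  Obj :: "'o set"
  Arr :: "'o \<Rightarrow> 'o \<Rightarrow> 'a set"
  ident :: "'o \<Rightarrow> 'a"
  comp :: "'o \<Rightarrow> 'o \<Rightarrow> 'o \<Rightarrow> 'a \<Rightarrow> 'a \<Rightarrow> 'a"

locale category =
  fixes C :: "('o, 'a) category"
  assumes ident_arr: "A \<in> Obj C \<Longrightarrow> ident C A \<in> Arr C A A"
    and comp_arr: "\<lbrakk>A \<in> Obj C; B \<in> Obj C; D \<in> Obj C; f \<in> Arr C A B; g \<in> Arr C B D\<rbrakk> \<Longrightarrow>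
      comp C A B D f g \<in> Arr C A D"
    and comp_ident_left: "\<lbrakk>A \<in> Obj C; B \<in> Obj C; f \<in> Arr C A B\<rbrakk> \<Longrightarrow>
      comp C A A B (ident C A) f = f"
    and comp_ident_right: "\<lbrakk>A \<in> Obj C; B \<in> Obj C; f \<in> Arr C A B\<rbrakk> \<Longrightarrow>
      comp C A B B f (ident C B) = f"
    and comp_assoc: "\<lbrakk>A \<in> Obj C; B \<in> Obj C; D \<in> Obj C; E \<in> Obj C;
        f \<in> Arr C A B; g \<in> Arr C B D; h \<in> Arr C D E\<rbrakk> \<Longrightarrow>
      comp C A D E (comp C A B D f g) h = comp C A B E f (comp C B D E g h)"

definition epimorphism :: "('o, 'a) category \<Rightarrow> 'o \<Rightarrow> 'o \<Rightarrow> 'a \<Rightarrow> bool" where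
  "epimorphism C A B e \<longleftrightarrow> e \<in> Arr C A B \<and>
    (\<forall>D\<in>Obj C. \<forall>f\<in>Arr C B D. \<forall>g\<in>Arr C B D. comp C A B D e f = comp C A B D e g \<longrightarrow> f = g)"

definition projective_object :: "('o, 'a) category \<Rightarrow> 'o \<Rightarrow> bool" where
  "projective_object C T \<longleftrightarrow> T \<in> Obj C \<and>
    (\<forall>A\<in>Obj C. \<forall>B\<in>Obj C. \<forall>e f. epimorphism C A B e \<longrightarrow> f \<in> Arr C T B \<longrightarrow>
      (\<exists>g\<in>Arr C T A. comp C T A B g e = f))"

section \<open>The adjoint category\<close>

text \<open>
  Values of \<open>form\<close> outside the carriers are unconstrained. Bimaps that differ only there are
  distinct but isomorphic objects of the adjoint category.
\<close>

record ('r, 's, 'u, 'v, 'w) bimap =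
  lmod :: "('r, 'u) module"
  rmod :: "('s, 'v) right_module"
  form :: "'u \<Rightarrow> 'v \<Rightarrow> 'w"

locale bimap =
  U: left_module R "lmod B" + V: right_module S "rmod B"
  for R (structure) and S (structure)
    and W :: "('r, 's, 'w) bimodule" and B :: "('r, 's, 'u, 'v, 'w) bimap" +
  assumes form_closed: "\<lbrakk>u \<in> carrier (lmod B); v \<in> carrier (rmod B)\<rbrakk> \<Longrightarrow> form B u v \<in> carrier W"
    and form_add_left:
      "\<lbrakk>u \<in> carrier (lmod B); u' \<in> carrier (lmod B); v \<in> carrier (rmod B)\<rbrakk> \<Longrightarrow>
        form B (u \<oplus>\<^bsub>lmod B\<^esub> u') v = form B u v \<oplus>\<^bsub>W\<^esub> form B u' v"
    and form_add_right:
      "\<lbrakk>u \<in> carrier (lmod B); v \<in> carrier (rmod B); v' \<in> carrier (rmod B)\<rbrakk> \<Longrightarrow>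
        form B u (v \<oplus>\<^bsub>rmod B\<^esub> v') = form B u v \<oplus>\<^bsub>W\<^esub> form B u v'"
    and form_smult:
      "\<lbrakk>r \<in> carrier R; u \<in> carrier (lmod B); v \<in> carrier (rmod B)\<rbrakk> \<Longrightarrow>
        form B (r \<odot>\<^bsub>lmod B\<^esub> u) v = r \<odot>\<^bsub>W\<^esub> form B u v"
    and form_rsmult:
      "\<lbrakk>s \<in> carrier S; u \<in> carrier (lmod B); v \<in> carrier (rmod B)\<rbrakk> \<Longrightarrow>
        form B u (v \<bullet>\<^bsub>rmod B\<^esub> s) = ract W (form B u v) s"

text \<open>
  The objects are all bimaps into \<open>W\<close> whose left modules have elements of type \<open>'u\<close> and whose
  right modules have elements of type \<open>'v\<close>. The two types are arbitrary, so they play the role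
  of an arbitrary universe: any set of bimaps into \<open>W\<close> has isomorphic copies over suitable
  types. A map is an epimorphism exactly when its left component is surjective and its right
  component is injective, whatever the universe; the test objects that show this are built on
  a quotient of a module over \<open>'u\<close> (take coset representatives) and on a submodule of a module
  over \<open>'v\<close>.
\<close>

definition Adj ::
  "('r, 'm) ring_scheme \<Rightarrow> ('s, 'n) ring_scheme \<Rightarrow> ('r, 's, 'w) bimodule \<Rightarrow>
    (('r, 's, 'u, 'v, 'w) bimap, ('u \<Rightarrow> 'u) \<times> ('v \<Rightarrow> 'v)) category" where
  "Adj R S W =
    \<lparr>Obj = {B. bimap R S W B},
     Arr = (\<lambda>B C. {(\<mu>, \<nu>). \<mu> \<in> lhom R (lmod B) (lmod C) \<and> \<nu> \<in> rhom S (rmod C) (rmod B) \<and>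
       (\<forall>u\<in>carrier (lmod B). \<forall>v\<in>carrier (rmod C). form C (\<mu> u) v = form B u (\<nu> v))}),
     ident = (\<lambda>B. (restrict id (carrier (lmod B)), restrict id (carrier (rmod B)))),
     comp = (\<lambda>B C D (\<mu>, \<nu>) (\<mu>', \<nu>').
       (compose (carrier (lmod B)) \<mu>' \<mu>, compose (carrier (rmod D)) \<nu> \<nu>'))\<rparr>"

lemma lhomD:
  assumes "f \<in> lhom R M N"
  shows "x \<in> carrier M \<Longrightarrow> f x \<in> carrier N"
    "x \<in> carrier M \<Longrightarrow> y \<in> carrier M \<Longrightarrow> f (x \<oplus>\<^bsub>M\<^esub> y) = f x \<oplus>\<^bsub>N\<^esub> f y"
     "r \<in> carrier R \<Longrightarrow> x \<in> carrier M \<Longrightarrow> f (r \<odot>\<^bsub>M\<^esub> x) = r \<odot>\<^bsub>N\<^esub> f x"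
    "f \<in> extensional (carrier M)"
  using assms by (auto simp: lhom_def PiE_def)

lemma rhomD:
  assumes "f \<in> rhom R M N"
  shows "x \<in> carrier M \<Longrightarrow> f x \<in> carrier N"
    "x \<in> carrier M \<Longrightarrow> y \<in> carrier M \<Longrightarrow> f (x \<oplus>\<^bsub>M\<^esub> y) = f x \<oplus>\<^bsub>N\<^esub> f y"
     "r \<in> carrier R \<Longrightarrow> x \<in> carrier M \<Longrightarrow> f (x \<bullet>\<^bsub>M\<^esub> r) = f x \<bullet>\<^bsub>N\<^esub> r"
    "f \<in> extensional (carrier M)"
  using assms by (auto simp: rhom_def PiE_def)

lemma lhomI:
  assumes "\<And>x. x \<in> carrier M \<Longrightarrow> f x \<in> carrier N"
    "\<And>x y. x \<in> carrier M \<Longrightarrow> y \<in> carrier M \<Longrightarrow> f (x \<oplus>\<^bsub>M\<^esub> y) = f x \<oplus>\<^bsub>N\<^esub> f y"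
    "\<And>r x. r \<in> carrier R \<Longrightarrow> x \<in> carrier M \<Longrightarrow> f (r \<odot>\<^bsub>M\<^esub> x) = r \<odot>\<^bsub>N\<^esub> f x"
    "f \<in> extensional (carrier M)"
  shows "f \<in> lhom R M N"
  using assms by (auto simp: lhom_def PiE_def)

lemma rhomI:
  assumes "\<And>x. x \<in> carrier M \<Longrightarrow> f x \<in> carrier N"
    "\<And>x y. x \<in> carrier M \<Longrightarrow> y \<in> carrier M \<Longrightarrow> f (x \<oplus>\<^bsub>M\<^esub> y) = f x \<oplus>\<^bsub>N\<^esub> f y"
    "\<And>r x. r \<in> carrier R \<Longrightarrow> x \<in> carrier M \<Longrightarrow> f (x \<bullet>\<^bsub>M\<^esub> r) = f x \<bullet>\<^bsub>N\<^esub> r"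
    "f \<in> extensional (carrier M)"
  shows "f \<in> rhom R M N"
  using assms by (auto simp: rhom_def PiE_def)

lemma lmod_cl: assumes "left_module R M" 
  shows "x \<in> carrier M \<Longrightarrow> y \<in> carrier M \<Longrightarrow> x \<oplus>\<^bsub>M\<^esub> y \<in> carrier M"
    "r \<in> carrier R \<Longrightarrow> x \<in> carrier M \<Longrightarrow> r \<odot>\<^bsub>M\<^esub> x \<in> carrier M"
  "\<zero>\<^bsub>M\<^esub> \<in> carrier M"
proof -
  interpret left_module R M by fact
  show "x \<in> carrier M \<Longrightarrow> y \<in> carrier M \<Longrightarrow> x \<oplus>\<^bsub>M\<^esub> y \<in> carrier M"
    "r \<in> carrier R \<Longrightarrow> x \<in> carrier M \<Longrightarrow> r \<odot>\<^bsub>M\<^esub> x \<in> carrier M"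
  "\<zero>\<^bsub>M\<^esub> \<in> carrier M" by auto
qed

lemma rmod_cl: assumes "right_module R M" 
  shows "x \<in> carrier M \<Longrightarrow> y \<in> carrier M \<Longrightarrow> x \<oplus>\<^bsub>M\<^esub> y \<in> carrier M"
    "r \<in> carrier R \<Longrightarrow> x \<in> carrier M \<Longrightarrow> x \<bullet>\<^bsub>M\<^esub> r \<in> carrier M"
  "\<zero>\<^bsub>M\<^esub> \<in> carrier M"
proof -
  interpret right_module R M by fact
  show "x \<in> carrier M \<Longrightarrow> y \<in> carrier M \<Longrightarrow> x \<oplus>\<^bsub>M\<^esub> y \<in> carrier M"
    "r \<in> carrier R \<Longrightarrow> x \<in> carrier M \<Longrightarrow> x \<bullet>\<^bsub>M\<^esub> r \<in> carrier M"
  "\<zero>\<^bsub>M\<^esub> \<in> carrier M" by auto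
qed

lemma lhom_comp: assumes "left_module R M" "f \<in> lhom R M N" "g \<in> lhom R N K" 
  shows "compose (carrier M) g f \<in> lhom R M K"
  using lhomD[OF assms(2)] lhomD[OF assms(3)] lmod_cl[OF assms(1)]
  by (intro lhomI) (auto simp: compose_def)

lemma rhom_comp: assumes "right_module R M" "f \<in> rhom R M N" "g \<in> rhom R N K" 
  shows "compose (carrier M) g f \<in> rhom R M K"
  using rhomD[OF assms(2)] rhomD[OF assms(3)] rmod_cl[OF assms(1)]
  by (intro rhomI) (auto simp: compose_def)

lemma lhom_id: assumes "left_module R M" shows "restrict id (carrier M) \<in> lhom R M M"
  using lmod_cl[OF assms(1)] by (intro lhomI) (auto)

lemma rhom_id: assumes "right_module R M" shows "restrict id (carrier M) \<in> rhom R M M"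
  using rmod_cl[OF assms(1)] by (intro rhomI) (auto)

lemma bimap_mods: "bimap R S W B \<Longrightarrow> left_module R (lmod B)" "bimap R S W B \<Longrightarrow> right_module S (rmod B)"
  by (auto simp: bimap_def)

lemma Adj_simps: "Obj (Adj R S W) = {B. bimap R S W B}"
  "(p \<in> Arr (Adj R S W) B C) = (fst p \<in> lhom R (lmod B) (lmod C) \<and> snd p \<in> rhom S (rmod C) (rmod B) \<and>
       (\<forall>u\<in>carrier (lmod B). \<forall>v\<in>carrier (rmod C). form C (fst p u) v = form B u (snd p v)))"
  "comp (Adj R S W) B C D p q = (compose (carrier (lmod B)) (fst q) (fst p), compose (carrier (rmod D)) (snd p) (snd q))"
  "ident (Adj R S W) B = (restrict id (carrier (lmod B)), restrict id (carrier (rmod B)))"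
  by (auto simp: Adj_def split: prod.splits)

lemma category_Adj: "category (Adj R S W)"
proof
  fix A assume "A \<in> Obj (Adj R S W)"
  thus "ident (Adj R S W) A \<in> Arr (Adj R S W) A A"
    by (auto simp: Adj_simps lhom_id rhom_id bimap_mods)
next
  fix A B D f g assume a: "A \<in> Obj (Adj R S W)" "B \<in> Obj (Adj R S W)" "D \<in> Obj (Adj R S W)"
    "f \<in> Arr (Adj R S W) A B" "g \<in> Arr (Adj R S W) B D"
  show "comp (Adj R S W) A B D f g \<in> Arr (Adj R S W) A D"
    using a by (auto simp: Adj_simps compose_eq intro!: lhom_comp rhom_comp dest: bimap_mods)
      (simp add: lhomD(1) rhomD(1))
next
  fix A B f assume a: "A \<in> Obj (Adj R S W)" "B \<in> Obj (Adj R S W)"  "f \<in> Arr (Adj R S W) A B"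
  then show "comp (Adj R S W) A A B (ident (Adj R S W) A) f = f"
    by (auto simp: Adj_simps  intro!: prod_eqI extensionalityI[OF compose_extensional] lhomD(4) rhomD(4))
     (auto simp: compose_def lhomD(1) rhomD(1))
  from a show "comp (Adj R S W) A B B f (ident (Adj R S W) B) = f"
    by (auto simp: Adj_simps  intro!: prod_eqI extensionalityI[OF compose_extensional] lhomD(4) rhomD(4))
     (auto simp: compose_def lhomD(1) rhomD(1))
next
  fix A B D E f g h assume a: "A \<in> Obj (Adj R S W)" "B \<in> Obj (Adj R S W)" "D \<in> Obj (Adj R S W)" "E \<in> Obj (Adj R S W)"
    "f \<in> Arr (Adj R S W) A B" "g \<in> Arr (Adj R S W) B D" "h \<in> Arr (Adj R S W) D E"
  show "comp (Adj R S W) A D E (comp (Adj R S W) A B D f g) h = comp (Adj R S W) A B E f (comp (Adj R S W) B D E g h)"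
    using a by (auto simp: Adj_simps compose_def lhomD(1) rhomD(1) intro!: restrict_ext)
qed

section \<open>The left versor\<close>

definition Hom_module ::
  "('r, 'm) ring_scheme \<Rightarrow> ('r, 'u) module \<Rightarrow> ('r, 's, 'w) bimodule \<Rightarrow> ('s, 'u \<Rightarrow> 'w) right_module"
  where "Hom_module R U W =
    \<lparr>carrier = lhom R U W, monoid.mult = undefined, one = undefined,
     zero = (\<lambda>x\<in>carrier U. \<zero>\<^bsub>W\<^esub>),
     add = (\<lambda>\<tau> \<tau>'. \<lambda>x\<in>carrier U. \<tau> x \<oplus>\<^bsub>W\<^esub> \<tau>' x),
     rsmult = (\<lambda>\<tau> s. \<lambda>x\<in>carrier U. ract W (\<tau> x) s)\<rparr>"

text \<open>
  The elements of \<open>Hom\<^sub>R(U, W)\<close> have type \<open>'u \<Rightarrow> 'w\<close>, whereas the right modules of the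
  adjoint category have elements of an arbitrary type \<open>'v\<close>. An embedding \<open>\<iota>\<close> of
  \<open>Hom\<^sub>R(U, W)\<close> into \<open>'v\<close> relabels its elements. For \<open>'v = ('u \<Rightarrow> 'w)\<close> and \<open>\<iota> = id\<close> the
  versor is the evaluation \<open>(x, \<tau>) \<mapsto> x\<tau>\<close> on \<open>U \<times> Hom\<^sub>R(U, W)\<close> itself.
\<close>

definition relabel :: "('a \<Rightarrow> 'v) \<Rightarrow> ('s, 'a) right_module \<Rightarrow> ('s, 'v) right_module" where
  "relabel \<iota> M =
    (let \<kappa> = the_inv_into (carrier M) \<iota> in
     \<lparr>carrier = \<iota> ` carrier M, monoid.mult = undefined, one = undefined,
      zero = \<iota> \<zero>\<^bsub>M\<^esub>,
      add = (\<lambda>v v'. \<iota> (\<kappa> v \<oplus>\<^bsub>M\<^esub> \<kappa> v')),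
      rsmult = (\<lambda>v s. \<iota> (\<kappa> v \<bullet>\<^bsub>M\<^esub> s))\<rparr>)"

definition left_versor ::
  "('r, 'm) ring_scheme \<Rightarrow> ('r, 's, 'w) bimodule \<Rightarrow> (('u \<Rightarrow> 'w) \<Rightarrow> 'v) \<Rightarrow> ('r, 'u) module \<Rightarrow>
    ('r, 's, 'u, 'v, 'w) bimap" where
  "left_versor R W \<iota> U =
    \<lparr>lmod = U, rmod = relabel \<iota> (Hom_module R U W),
     form = (\<lambda>x v. the_inv_into (lhom R U W) \<iota> v x)\<rparr>"

lemma form_left_versor:
  assumes "inj_on \<iota> (lhom R U W)" and "\<tau> \<in> lhom R U W"
  shows "form (left_versor R W \<iota> U) x (\<iota> \<tau>) = \<tau> x"
  using assms by (simp add: left_versor_def the_inv_into_f_f)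

end

theory Submission
  imports Defs "HOL-Algebra.AbelCoset"
begin

text \<open>
  Let \<open>e = (\<mu>, \<nu>)\<close> be an epimorphism from \<open>A\<close> to \<open>B\<close> and \<open>(f\<^sub>1, f\<^sub>2)\<close> a morphism from the versor
  to \<open>B\<close>. If \<open>\<mu>\<close> is surjective, then projectivity of \<open>P\<close> lifts \<open>f\<^sub>1\<close> to \<open>g\<^sub>1\<close> with
  \<open>\<mu> (g\<^sub>1 x) = f\<^sub>1 x\<close>, and the universal property of the versor leaves exactly one candidate for the
  right component: \<open>g\<^sub>2 v\<close> is the homomorphism \<open>x \<mapsto> form A (g\<^sub>1 x) v\<close>. The pair is a lift of
  \<open>(f\<^sub>1, f\<^sub>2)\<close> because
  \<open>form A (g\<^sub>1 x) (\<nu> v) = form B (\<mu> (g\<^sub>1 x)) v = form B (f\<^sub>1 x) v\<close>, which is \<open>f\<^sub>2 v\<close> evaluated at \<open>x\<close>.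

  Surjectivity of \<open>\<mu>\<close> (\<open>epimorphism_Adj_surj\<close>) comes from the cokernel of \<open>\<mu>\<close>. Paired with the zero
  right module it is an object of the adjoint category, for every form vanishes on it; the
  projection and the zero map are the left components of two morphisms from \<open>B\<close> to this object
  that agree after \<open>e\<close>, so they are equal and the cokernel is zero.

  Two constructions have to be moved to prescribed types: the cokernel must consist of elements of
  the type of the given module, and the modules in the definition of projectivity consist of
  elements of a sum type. Both are images of a module under a map with a choice of representatives
  (\<open>image_module\<close>).
\<close>

section \<open>Homomorphic images of modules\<close>

lemma abelian_group_image:
  assumes M: "abelian_group M"
    and carrier: "carrier N = f ` carrier M"
    and zero: "\<zero>\<^bsub>N\<^esub> = f \<zero>\<^bsub>M\<^esub>"
    and add: "\<And>x y. x \<in> carrier M \<Longrightarrow> y \<in> carrier M \<Longrightarrow> f x \<oplus>\<^bsub>N\<^esub> f y = f (x \<oplus>\<^bsub>M\<^esub> y)"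
  shows "abelian_group N"
proof -
  interpret M: abelian_group M by fact
  show ?thesis
  proof (rule abelian_groupI)
    fix x assume "x \<in> carrier N"
    then obtain a where a: "x = f a" "a \<in> carrier M" using carrier by auto
    have "f (\<ominus>\<^bsub>M\<^esub> a) \<oplus>\<^bsub>N\<^esub> x = \<zero>\<^bsub>N\<^esub>" using a by (simp add: add zero M.l_neg)
    then show "\<exists>y\<in>carrier N. y \<oplus>\<^bsub>N\<^esub> x = \<zero>\<^bsub>N\<^esub>" using a carrier by auto
  qed (auto simp: carrier zero add M.a_ac)
qed

lemma left_module_image:
  assumes M: "left_module R M"
    and carrier: "carrier N = f ` carrier M"
    and zero: "\<zero>\<^bsub>N\<^esub> = f \<zero>\<^bsub>M\<^esub>"
    and add: "\<And>x y. x \<in> carrier M \<Longrightarrow> y \<in> carrier M \<Longrightarrow> f x \<oplus>\<^bsub>N\<^esub> f y = f (x \<oplus>\<^bsub>M\<^esub> y)"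
    and smult: "\<And>r x. r \<in> carrier R \<Longrightarrow> x \<in> carrier M \<Longrightarrow> r \<odot>\<^bsub>N\<^esub> f x = f (r \<odot>\<^bsub>M\<^esub> x)"
  shows "left_module R N"
proof -
  interpret M: left_module R M by fact
  interpret N: abelian_group N
    using abelian_group_image[OF M.abelian_group_axioms carrier zero add] .
  show ?thesis
    by unfold_locales
      (auto simp: carrier add smult M.smult_l_distr M.smult_r_distr M.smult_assoc M.smult_one)
qed

lemma right_module_image:
  assumes M: "right_module S M"
    and carrier: "carrier N = f ` carrier M"
    and zero: "\<zero>\<^bsub>N\<^esub> = f \<zero>\<^bsub>M\<^esub>"
    and add: "\<And>x y. x \<in> carrier M \<Longrightarrow> y \<in> carrier M \<Longrightarrow> f x \<oplus>\<^bsub>N\<^esub> f y = f (x \<oplus>\<^bsub>M\<^esub> y)"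
    and rsmult: "\<And>s x. s \<in> carrier S \<Longrightarrow> x \<in> carrier M \<Longrightarrow> f x \<bullet>\<^bsub>N\<^esub> s = f (x \<bullet>\<^bsub>M\<^esub> s)"
  shows "right_module S N"
proof -
  interpret M: right_module S M by fact
  interpret N: abelian_group N
    using abelian_group_image[OF M.abelian_group_axioms carrier zero add] .
  show ?thesis
    by unfold_locales
      (auto simp: carrier add rsmult M.rsmult_l_distr M.rsmult_r_distr M.rsmult_assoc M.rsmult_one)
qed

text \<open>
  The operations are computed on the representatives that \<open>s\<close> picks in the fibres of \<open>f\<close>. An
  injective \<open>f\<close> with left inverse \<open>s\<close> gives a copy of \<open>M\<close> over another type; a map \<open>f\<close> that sends
  each element to a chosen representative of its coset, with \<open>s = id\<close>, gives a quotient of \<open>M\<close> over the type of \<open>M\<close>.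
\<close>

definition image_module ::
  "('a \<Rightarrow> 'b) \<Rightarrow> ('b \<Rightarrow> 'a) \<Rightarrow> ('r, 'a, 'p) module_scheme \<Rightarrow> ('r, 'b) module" where
  "image_module f s M =
    \<lparr>carrier = f ` carrier M, monoid.mult = undefined, one = undefined,
     zero = f \<zero>\<^bsub>M\<^esub>, add = (\<lambda>x y. f (s x \<oplus>\<^bsub>M\<^esub> s y)), smult = (\<lambda>r x. f (r \<odot>\<^bsub>M\<^esub> s x))\<rparr>"

lemma image_module_simps:
  "carrier (image_module f s M) = f ` carrier M"
  "\<zero>\<^bsub>image_module f s M\<^esub> = f \<zero>\<^bsub>M\<^esub>"
  "x \<oplus>\<^bsub>image_module f s M\<^esub> y = f (s x \<oplus>\<^bsub>M\<^esub> s y)"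
  "r \<odot>\<^bsub>image_module f s M\<^esub> x = f (r \<odot>\<^bsub>M\<^esub> s x)"
  by (simp_all add: image_module_def)

lemma left_module_image_module:
  assumes "left_module R M"
    and "\<And>x y. x \<in> carrier M \<Longrightarrow> y \<in> carrier M \<Longrightarrow> f (s (f x) \<oplus>\<^bsub>M\<^esub> s (f y)) = f (x \<oplus>\<^bsub>M\<^esub> y)"
    and "\<And>r x. r \<in> carrier R \<Longrightarrow> x \<in> carrier M \<Longrightarrow> f (r \<odot>\<^bsub>M\<^esub> s (f x)) = f (r \<odot>\<^bsub>M\<^esub> x)"
  shows "left_module R (image_module f s M)"
  by (rule left_module_image[OF assms(1), of _ f]) (simp_all add: image_module_simps assms)

text \<open>
  The lifting property is defined by modules over a sum type, and \<open>Inr\<close> copies any pair of modules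
  over the right summand into that type.
\<close>

lemma projective_module_lift:
  fixes P M N :: "('r, 'u) module"
  assumes P: "projective_module R P"
    and M: "left_module R M" and N: "left_module R N"
    and g: "g \<in> lhom R M N" and surj: "g ` carrier M = carrier N"
    and f: "f \<in> lhom R P N"
  shows "\<exists>h\<in>lhom R P M. compose (carrier P) g h = f"
proof -
  let ?in = "Inr :: 'u \<Rightarrow> ('u \<Rightarrow> 'r) + 'u"
  define M' where "M' = image_module ?in projr M"
  define N' where "N' = image_module ?in projr N"
  define g' where "g' = (\<lambda>x\<in>carrier M'. ?in (g (projr x)))"
  define f' where "f' = (\<lambda>x\<in>carrier P. ?in (f x))"
  note M'_simps = M'_def N'_def image_module_simps
  interpret P: left_module R P using P by (simp add: projective_module_def)
  have M': "left_module R M'" and N': "left_module R N'"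
    using M N by (auto simp: M'_def N'_def intro: left_module_image_module)
  have "g' \<in> lhom R M' N'"
    using lhomD[OF g] lmod_cl[OF M] by (intro lhomI) (auto simp: g'_def M'_simps)
  moreover have "g' ` carrier M' = carrier N'"
    unfolding g'_def M'_simps surj[symmetric] by force
  moreover have "f' \<in> lhom R P N'"
    using lhomD[OF f] by (intro lhomI) (auto simp: f'_def M'_simps)
  ultimately obtain h' where h': "h' \<in> lhom R P M'" and eq: "compose (carrier P) g' h' = f'"
    using P M' N' unfolding projective_module_def by blast
  have h'_in: "\<exists>m\<in>carrier M. h' x = ?in m" if "x \<in> carrier P" for x
    using lhomD(1)[OF h' that] by (auto simp: M'_simps)
  define h where "h = (\<lambda>x\<in>carrier P. projr (h' x))"
  have "h \<in> lhom R P M"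
  proof (intro lhomI)
    show "h x \<in> carrier M" if "x \<in> carrier P" for x
      using h'_in[OF that] that by (auto simp: h_def)
  qed (auto simp: h_def lhomD[OF h'] M'_simps)
  moreover have "compose (carrier P) g h = f"
  proof (rule extensionalityI[OF compose_extensional lhomD(4)[OF f]])
    fix x assume x: "x \<in> carrier P"
    have "?in (g (h x)) = compose (carrier P) g' h' x"
      using x lhomD(1)[OF h' x] by (simp add: compose_def g'_def h_def)
    also have "\<dots> = ?in (f x)" using x by (simp add: eq f'_def)
    finally show "compose (carrier P) g h x = f x" using x by (simp add: compose_def)
  qed
  ultimately show ?thesis by blast
qed

section \<open>Zero in modules and bimaps\<close>

lemma (in abelian_group) idem_zero:
  assumes "x \<in> carrier G" and "x \<oplus> x = x"
  shows "x = \<zero>"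
  using assms add.r_cancel_one by blast

lemma (in left_module) smult_zero:
  assumes "r \<in> carrier R"
  shows "r \<odot>\<^bsub>M\<^esub> \<zero>\<^bsub>M\<^esub> = \<zero>\<^bsub>M\<^esub>"
  using M.idem_zero smult_r_distr[OF assms M.zero_closed M.zero_closed] assms by simp

lemma (in left_module) smult_minus:
  assumes "r \<in> carrier R" and "x \<in> carrier M"
  shows "r \<odot>\<^bsub>M\<^esub> (\<ominus>\<^bsub>M\<^esub> x) = \<ominus>\<^bsub>M\<^esub> (r \<odot>\<^bsub>M\<^esub> x)"
proof (rule sym, rule M.minus_equality)
  show "r \<odot>\<^bsub>M\<^esub> (\<ominus>\<^bsub>M\<^esub> x) \<oplus>\<^bsub>M\<^esub> r \<odot>\<^bsub>M\<^esub> x = \<zero>\<^bsub>M\<^esub>"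
    using assms smult_r_distr[of r "\<ominus>\<^bsub>M\<^esub> x" x] by (simp add: M.l_neg smult_zero)
qed (use assms in auto)

lemma (in right_module) zero_rsmult:
  assumes "s \<in> carrier S"
  shows "\<zero>\<^bsub>M\<^esub> \<bullet>\<^bsub>M\<^esub> s = \<zero>\<^bsub>M\<^esub>"
  using M.idem_zero rsmult_l_distr[OF M.zero_closed M.zero_closed assms] assms by simp

lemma right_part_simps:
  "carrier (right_part W) = carrier W" "\<zero>\<^bsub>right_part W\<^esub> = \<zero>\<^bsub>W\<^esub>"
  "x \<oplus>\<^bsub>right_part W\<^esub> y = x \<oplus>\<^bsub>W\<^esub> y" "x \<bullet>\<^bsub>right_part W\<^esub> s = ract W x s"
  by (simp_all add: right_part_def)

lemmas (in bimodule) ract_closed = right.rsmult_closed[unfolded right_part_simps]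
lemmas (in bimodule) ract_r_distr = right.rsmult_r_distr[unfolded right_part_simps]
lemmas (in bimodule) ract_l_distr = right.rsmult_l_distr[unfolded right_part_simps]
lemmas (in bimodule) ract_assoc = right.rsmult_assoc[unfolded right_part_simps]
lemmas (in bimodule) ract_one = right.rsmult_one[unfolded right_part_simps]
lemmas (in bimodule) zero_ract = right.zero_rsmult[unfolded right_part_simps]

lemma (in bimap) form_zero_right:
  assumes "abelian_group W" and "u \<in> carrier (lmod B)"
  shows "form B u \<zero>\<^bsub>rmod B\<^esub> = \<zero>\<^bsub>W\<^esub>"
  using abelian_group.idem_zero[OF assms(1)] form_closed[OF assms(2) V.zero_closed]
    form_add_right[OF assms(2) V.zero_closed V.zero_closed] by simp

section \<open>The versor is a bimap\<close>

lemma Hom_module_simps: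
  "carrier (Hom_module R U W) = lhom R U W"
  "\<zero>\<^bsub>Hom_module R U W\<^esub> = (\<lambda>x\<in>carrier U. \<zero>\<^bsub>W\<^esub>)"
  "\<tau> \<oplus>\<^bsub>Hom_module R U W\<^esub> \<tau>' = (\<lambda>x\<in>carrier U. \<tau> x \<oplus>\<^bsub>W\<^esub> \<tau>' x)"
  "\<tau> \<bullet>\<^bsub>Hom_module R U W\<^esub> s = (\<lambda>x\<in>carrier U. ract W (\<tau> x) s)"
  by (simp_all add: Hom_module_def)

lemma right_module_Hom_module:
  assumes W: "bimodule R S W" and U: "left_module R U"
  shows "right_module S (Hom_module R U W)"
proof -
  interpret W: bimodule R S W by fact
  interpret U: left_module R U by fact
  have zero: "(\<lambda>x\<in>carrier U. \<zero>\<^bsub>W\<^esub>) \<in> lhom R U W"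
    by (intro lhomI) (auto simp: W.smult_zero)
  have add: "(\<lambda>x\<in>carrier U. \<sigma> x \<oplus>\<^bsub>W\<^esub> \<tau> x) \<in> lhom R U W"
    if "\<sigma> \<in> lhom R U W" "\<tau> \<in> lhom R U W" for \<sigma> \<tau>
    using lhomD[OF that(1)] lhomD[OF that(2)]
    by (intro lhomI) (auto simp: W.smult_r_distr W.M.a_ac)
  have neg: "(\<lambda>x\<in>carrier U. \<ominus>\<^bsub>W\<^esub> \<tau> x) \<in> lhom R U W" if "\<tau> \<in> lhom R U W" for \<tau>
    using lhomD[OF that] by (intro lhomI) (auto simp: W.smult_minus W.M.minus_add)
  have act: "(\<lambda>x\<in>carrier U. ract W (\<tau> x) s) \<in> lhom R U W"
    if "\<tau> \<in> lhom R U W" "s \<in> carrier S" for \<tau> s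
    using lhomD[OF that(1)] that(2)
    by (intro lhomI) (auto simp: W.ract_closed W.ract_l_distr W.smult_ract)
  have "abelian_group (Hom_module R U W)"
  proof (rule abelian_groupI, unfold Hom_module_simps)
    fix \<tau> assume \<tau>: "\<tau> \<in> lhom R U W"
    show "(\<lambda>x\<in>carrier U. (\<lambda>x\<in>carrier U. \<zero>\<^bsub>W\<^esub>) x \<oplus>\<^bsub>W\<^esub> \<tau> x) = \<tau>"
      using lhomD[OF \<tau>] by (intro extensionalityI[OF restrict_extensional]) auto
    show "\<exists>\<sigma>\<in>lhom R U W. (\<lambda>x\<in>carrier U. \<sigma> x \<oplus>\<^bsub>W\<^esub> \<tau> x) = (\<lambda>x\<in>carrier U. \<zero>\<^bsub>W\<^esub>)"
      using lhomD(1)[OF \<tau>] by (intro bexI[OF _ neg[OF \<tau>]] restrict_ext) (simp add: W.M.l_neg)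
  qed (auto simp: zero add lhomD(1) W.M.a_ac intro!: restrict_ext)
  then interpret H: abelian_group "Hom_module R U W" .
  show ?thesis
  proof (unfold_locales, unfold Hom_module_simps)
    fix \<tau> assume \<tau>: "\<tau> \<in> lhom R U W"
    show "(\<lambda>x\<in>carrier U. ract W (\<tau> x) \<one>\<^bsub>S\<^esub>) = \<tau>"
      using lhomD[OF \<tau>]
      by (intro extensionalityI[OF restrict_extensional]) (auto simp: W.ract_one)
  qed (auto simp: act lhomD(1) W.ract_l_distr W.ract_r_distr W.ract_assoc intro!: restrict_ext)
qed

lemma relabel_simps:
  assumes "inj_on \<iota> (carrier M)"
  shows "carrier (relabel \<iota> M) = \<iota> ` carrier M"
    and "\<zero>\<^bsub>relabel \<iota> M\<^esub> = \<iota> \<zero>\<^bsub>M\<^esub>"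
    and "x \<in> carrier M \<Longrightarrow> y \<in> carrier M \<Longrightarrow> \<iota> x \<oplus>\<^bsub>relabel \<iota> M\<^esub> \<iota> y = \<iota> (x \<oplus>\<^bsub>M\<^esub> y)"
    and "x \<in> carrier M \<Longrightarrow> \<iota> x \<bullet>\<^bsub>relabel \<iota> M\<^esub> s = \<iota> (x \<bullet>\<^bsub>M\<^esub> s)"
  using assms by (simp_all add: relabel_def Let_def the_inv_into_f_f)

lemma right_module_relabel:
  assumes "right_module S M" and "inj_on \<iota> (carrier M)"
  shows "right_module S (relabel \<iota> M)"
  by (rule right_module_image[OF assms(1), of _ \<iota>]) (simp_all add: relabel_simps[OF assms(2)])

lemma bimap_left_versor:
  assumes W: "bimodule R S W" and U: "left_module R U" and \<iota>: "inj_on \<iota> (lhom R U W)"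
  shows "bimap R S W (left_versor R W \<iota> U)"
proof -
  have H: "right_module S (Hom_module R U W)"
    using right_module_Hom_module[OF W U] .
  have \<iota>': "inj_on \<iota> (carrier (Hom_module R U W))" using \<iota> by (simp add: Hom_module_simps)
  note simps = form_left_versor[OF \<iota>] relabel_simps[OF \<iota>', unfolded Hom_module_simps(1)]
  have mods: "lmod (left_versor R W \<iota> U) = U"
    "rmod (left_versor R W \<iota> U) = relabel \<iota> (Hom_module R U W)"
    by (simp_all add: left_versor_def)
  show ?thesis
  proof (intro bimap.intro bimap_axioms.intro; (unfold mods simps(2))?)
    fix u v v' assume u: "u \<in> carrier U" and "v \<in> \<iota> ` lhom R U W" "v' \<in> \<iota> ` lhom R U W"
    then obtain \<tau> \<tau>' where \<tau>: "v = \<iota> \<tau>" "v' = \<iota> \<tau>'" "\<tau> \<in> lhom R U W" "\<tau>' \<in> lhom R U W"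
      by auto
    then have "\<tau> \<oplus>\<^bsub>Hom_module R U W\<^esub> \<tau>' \<in> lhom R U W"
      using rmod_cl(1)[OF H] by (simp add: Hom_module_simps(1))
    then show "form (left_versor R W \<iota> U) u (v \<oplus>\<^bsub>relabel \<iota> (Hom_module R U W)\<^esub> v')
        = form (left_versor R W \<iota> U) u v \<oplus>\<^bsub>W\<^esub> form (left_versor R W \<iota> U) u v'"
      using u \<tau> by (simp add: simps) (simp add: Hom_module_simps)
  next
    fix s u v assume s: "s \<in> carrier S" and u: "u \<in> carrier U" and "v \<in> \<iota> ` lhom R U W"
    then obtain \<tau> where \<tau>: "v = \<iota> \<tau>" "\<tau> \<in> lhom R U W" by auto
    then have "\<tau> \<bullet>\<^bsub>Hom_module R U W\<^esub> s \<in> lhom R U W"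
      using rmod_cl(2)[OF H s] by (simp add: Hom_module_simps(1))
    then show "form (left_versor R W \<iota> U) u (v \<bullet>\<^bsub>relabel \<iota> (Hom_module R U W)\<^esub> s)
        = ract W (form (left_versor R W \<iota> U) u v) s"
      using u \<tau> by (simp add: simps) (simp add: Hom_module_simps)
  qed (auto simp: U right_module_relabel[OF H \<iota>'] simps lhomD)
qed

section \<open>Epimorphisms are surjective on left modules\<close>

text \<open>
  The coset representatives of \<open>K\<close> form a module over the type of \<open>M\<close>, and sending an element to
  the representative of its coset is the canonical projection.
\<close>

lemma quotient_module_exists:
  fixes M :: "('r, 'u) module"
  assumes M: "left_module R M"
    and K: "additive_subgroup K M"
    and smult: "\<And>r k. r \<in> carrier R \<Longrightarrow> k \<in> K \<Longrightarrow> r \<odot>\<^bsub>M\<^esub> k \<in> K"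
  obtains Q :: "('r, 'u) module" and \<pi>
  where "left_module R Q" and "\<pi> \<in> lhom R M Q"
    and "\<And>x. x \<in> carrier M \<Longrightarrow> \<pi> x = \<zero>\<^bsub>Q\<^esub> \<longleftrightarrow> x \<in> K"
proof -
  interpret M: left_module R M by fact
  interpret K: abelian_subgroup K M
    using abelian_subgroupI3[OF K M.abelian_group_axioms] .
  define rep where "rep x = (SOME y. y \<in> K +>\<^bsub>M\<^esub> x)" for x
  have rep: "rep x \<in> K +>\<^bsub>M\<^esub> x" if "x \<in> carrier M" for x
    unfolding rep_def by (rule someI) (rule K.a_rcos_self[OF that])
  have rep_diff: "\<exists>k\<in>K. rep x = k \<oplus>\<^bsub>M\<^esub> x" if "x \<in> carrier M" for x
    using rep[OF that] by (auto simp: a_r_coset_def')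
  have rep_closed: "rep x \<in> carrier M" if "x \<in> carrier M" for x
    using rep_diff[OF that] that K.a_subset by auto
  have rep_add: "rep (k \<oplus>\<^bsub>M\<^esub> x) = rep x" if "k \<in> K" "x \<in> carrier M" for k x
  proof -
    have "k \<oplus>\<^bsub>M\<^esub> x \<in> K +>\<^bsub>M\<^esub> x" using that by (auto simp: a_r_coset_def')
    then show ?thesis unfolding rep_def using K.a_repr_independence' that by simp
  qed
  define Q where "Q = image_module rep id M"
  define \<pi> where "\<pi> = restrict rep (carrier M)"
  have add: "rep (rep x \<oplus>\<^bsub>M\<^esub> rep y) = rep (x \<oplus>\<^bsub>M\<^esub> y)"
    if x: "x \<in> carrier M" and y: "y \<in> carrier M" for x y
  proof -
    obtain k l where k: "k \<in> K" "rep x = k \<oplus>\<^bsub>M\<^esub> x" and l: "l \<in> K" "rep y = l \<oplus>\<^bsub>M\<^esub> y"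
      using rep_diff x y by blast
    have "rep x \<oplus>\<^bsub>M\<^esub> rep y = (k \<oplus>\<^bsub>M\<^esub> l) \<oplus>\<^bsub>M\<^esub> (x \<oplus>\<^bsub>M\<^esub> y)"
      using k l x y K.a_subset by (simp add: M.M.a_ac subset_iff)
    then show ?thesis using rep_add[of "k \<oplus>\<^bsub>M\<^esub> l" "x \<oplus>\<^bsub>M\<^esub> y"] k l x y by simp
  qed
  have sm: "rep (r \<odot>\<^bsub>M\<^esub> rep x) = rep (r \<odot>\<^bsub>M\<^esub> x)" if r: "r \<in> carrier R" and x: "x \<in> carrier M" for r x
  proof -
    obtain k where k: "k \<in> K" "rep x = k \<oplus>\<^bsub>M\<^esub> x" using rep_diff x by blast
    then show ?thesis
      using rep_add[OF smult[OF r k(1)], of "r \<odot>\<^bsub>M\<^esub> x"] r x K.a_subset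
      by (auto simp: M.smult_r_distr subset_iff)
  qed
  show thesis
  proof
    show "left_module R Q"
      unfolding Q_def by (rule left_module_image_module[OF M]) (simp_all add: add sm)
    show "\<pi> \<in> lhom R M Q"
      by (intro lhomI) (auto simp: \<pi>_def Q_def image_module_simps add sm)
    fix x assume x: "x \<in> carrier M"
    have "rep x = rep \<zero>\<^bsub>M\<^esub> \<longleftrightarrow> x \<in> K"
    proof
      assume eq: "rep x = rep \<zero>\<^bsub>M\<^esub>"
      obtain k l where k: "k \<in> K" "rep x = k \<oplus>\<^bsub>M\<^esub> x" and l: "l \<in> K" "rep x = l \<oplus>\<^bsub>M\<^esub> \<zero>\<^bsub>M\<^esub>"
        using rep_diff[OF x] rep_diff[of "\<zero>\<^bsub>M\<^esub>"] eq by auto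
      have kM: "k \<in> carrier M" and lM: "l \<in> carrier M" using k l K.a_subset by auto
      have "x = \<ominus>\<^bsub>M\<^esub> k \<oplus>\<^bsub>M\<^esub> (k \<oplus>\<^bsub>M\<^esub> x)" using kM x by (simp add: M.M.r_neg1)
      also have "\<dots> = \<ominus>\<^bsub>M\<^esub> k \<oplus>\<^bsub>M\<^esub> l" using k l lM by simp
      finally show "x \<in> K" using k l by (simp add: K.a_inv_closed)
    next
      assume "x \<in> K"
      then show "rep x = rep \<zero>\<^bsub>M\<^esub>" using rep_add[of x "\<zero>\<^bsub>M\<^esub>"] x by simp
    qed
    then show "\<pi> x = \<zero>\<^bsub>Q\<^esub> \<longleftrightarrow> x \<in> K" using x by (simp add: \<pi>_def Q_def image_module_simps)
  qed
qed

lemma lhom_image_subgroup: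
  assumes M: "left_module R M" and N: "left_module R N" and f: "f \<in> lhom R M N"
  shows "additive_subgroup (f ` carrier M) N"
proof -
  interpret M: left_module R M by fact
  interpret N: left_module R N by fact
  note f = lhomD[OF f]
  have zero: "f \<zero>\<^bsub>M\<^esub> = \<zero>\<^bsub>N\<^esub>"
    using N.M.idem_zero[OF f(1)] f(2)[of "\<zero>\<^bsub>M\<^esub>" "\<zero>\<^bsub>M\<^esub>"] by simp
  have minus: "\<ominus>\<^bsub>N\<^esub> f x = f (\<ominus>\<^bsub>M\<^esub> x)" if "x \<in> carrier M" for x
    using that f(1) f(2)[of "\<ominus>\<^bsub>M\<^esub> x" x] by (intro N.M.minus_equality) (auto simp: M.M.l_neg zero)
  show ?thesis
  proof (intro additive_subgroup.intro N.M.add.subgroupI)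
    fix a assume "a \<in> f ` carrier M"
    then show "\<ominus>\<^bsub>N\<^esub> a \<in> f ` carrier M"
      by (auto simp: minus)
  next
    fix a b assume "a \<in> f ` carrier M" and "b \<in> f ` carrier M"
    then obtain x y where "x \<in> carrier M" "a = f x" "y \<in> carrier M" "b = f y" by auto
    then show "a \<oplus>\<^bsub>N\<^esub> b \<in> f ` carrier M" by (auto simp flip: f(2))
  qed (use f(1) in auto)
qed

text \<open>
  Over the zero right module the adjointness condition only involves values of forms at zero, so
  every homomorphism of left modules is the left component of a morphism.
\<close>

lemma extend_by_zero_right_module:
  fixes B :: "('r, 's, 'u, 'v, 'w) bimap" and Q :: "('r, 'u) module"
  assumes W: "bimodule R S W" and B: "bimap R S W B" and Q: "left_module R Q"
  obtains D :: "('r, 's, 'u, 'v, 'w) bimap" and \<nu>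
  where "bimap R S W D" and "lmod D = Q"
    and "\<And>\<pi>. \<pi> \<in> lhom R (lmod B) Q \<Longrightarrow> (\<pi>, \<nu>) \<in> Arr (Adj R S W) B D"
proof -
  interpret W: bimodule R S W by fact
  interpret B: bimap R S W B by fact
  define Z where "Z = (rmod B)\<lparr>carrier := {\<zero>\<^bsub>rmod B\<^esub>}\<rparr>"
  define D :: "('r, 's, 'u, 'v, 'w) bimap"
    where "D = \<lparr>lmod = Q, rmod = Z, form = (\<lambda>_ _. \<zero>\<^bsub>W\<^esub>)\<rparr>"
  have Z_simps: "carrier Z = {\<zero>\<^bsub>rmod B\<^esub>}" "\<zero>\<^bsub>Z\<^esub> = \<zero>\<^bsub>rmod B\<^esub>"
    "x \<oplus>\<^bsub>Z\<^esub> y = x \<oplus>\<^bsub>rmod B\<^esub> y" "x \<bullet>\<^bsub>Z\<^esub> s = x \<bullet>\<^bsub>rmod B\<^esub> s" for x y s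
    by (simp_all add: Z_def)
  have Z: "right_module S Z"
    using B.V.M.zero_closed
    by (intro right_module_image[OF B.V.right_module_axioms, of _ "\<lambda>_. \<zero>\<^bsub>rmod B\<^esub>"])
      (auto simp: Z_simps B.V.zero_rsmult)
  show thesis
  proof
    show "bimap R S W D"
      by (intro bimap.intro bimap_axioms.intro) (auto simp: D_def Q Z W.smult_zero W.zero_ract)
    show "lmod D = Q" by (simp add: D_def)
    fix \<pi> assume "\<pi> \<in> lhom R (lmod B) Q"
    moreover have "restrict id (carrier Z) \<in> rhom S Z (rmod B)"
      by (intro rhomI) (auto simp: Z_simps B.V.zero_rsmult)
    ultimately show "(\<pi>, restrict id (carrier Z)) \<in> Arr (Adj R S W) B D"
      using B.form_zero_right[OF W.M.abelian_group_axioms]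
      by (auto simp: Adj_simps D_def Z_simps)
  qed
qed

lemma epimorphism_Adj_surj:
  fixes A B :: "('r, 's, 'u, 'v, 'w) bimap"
  assumes W: "bimodule R S W" and A: "bimap R S W A" and B: "bimap R S W B"
    and epi: "epimorphism (Adj R S W) A B e"
  shows "fst e ` carrier (lmod A) = carrier (lmod B)"
proof
  interpret A: bimap R S W A by fact
  interpret B: bimap R S W B by fact
  let ?K = "fst e ` carrier (lmod A)"
  have e: "fst e \<in> lhom R (lmod A) (lmod B)"
    using epi by (simp add: epimorphism_def Adj_simps)
  show "?K \<subseteq> carrier (lmod B)" using lhomD(1)[OF e] by auto
  have "r \<odot>\<^bsub>lmod B\<^esub> k \<in> ?K" if "r \<in> carrier R" "k \<in> ?K" for r k
    using that by (auto simp flip: lhomD(3)[OF e])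
  then obtain Q :: "('r, 'u) module" and \<pi>
    where Q: "left_module R Q" and \<pi>: "\<pi> \<in> lhom R (lmod B) Q"
      and ker: "\<And>x. x \<in> carrier (lmod B) \<Longrightarrow> \<pi> x = \<zero>\<^bsub>Q\<^esub> \<longleftrightarrow> x \<in> ?K"
    using quotient_module_exists[OF B.U.left_module_axioms
        lhom_image_subgroup[OF A.U.left_module_axioms B.U.left_module_axioms e]] by metis
  interpret Q: left_module R Q by fact
  define \<omega> where "\<omega> = (\<lambda>x\<in>carrier (lmod B). \<zero>\<^bsub>Q\<^esub>)"
  have \<omega>: "\<omega> \<in> lhom R (lmod B) Q"
    by (intro lhomI) (auto simp: \<omega>_def Q.smult_zero)
  obtain D :: "('r, 's, 'u, 'v, 'w) bimap" and \<nu>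
    where D: "bimap R S W D" "lmod D = Q"
      and arr: "\<And>\<pi>. \<pi> \<in> lhom R (lmod B) Q \<Longrightarrow> (\<pi>, \<nu>) \<in> Arr (Adj R S W) B D"
    using extend_by_zero_right_module[OF W B Q] by metis
  have "compose (carrier (lmod A)) \<pi> (fst e) = compose (carrier (lmod A)) \<omega> (fst e)"
    unfolding compose_def using lhomD(1)[OF e] ker by (intro restrict_ext) (simp add: \<omega>_def)
  then have "comp (Adj R S W) A B D e (\<pi>, \<nu>) = comp (Adj R S W) A B D e (\<omega>, \<nu>)"
    by (simp add: Adj_simps)
  then have "(\<pi>, \<nu>) = (\<omega>, \<nu>)"
    using epi arr[OF \<pi>] arr[OF \<omega>] D(1) unfolding epimorphism_def Adj_simps(1) by blast
  then have "\<pi> x = \<zero>\<^bsub>Q\<^esub>" if "x \<in> carrier (lmod B)" for x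
    using that by (simp add: \<omega>_def)
  then show "carrier (lmod B) \<subseteq> ?K" using ker by auto
qed

section \<open>Morphisms from the versor\<close>

text \<open>
  Adjointness asks that the right component send \<open>v\<close> to an element of \<open>Hom\<^sub>R(P, W)\<close> with value
  \<open>form A (g x) v\<close> at \<open>x\<close>. As \<open>form A\<close> is additive and \<open>R\<close>-linear on the left, these values do form a
  homomorphism, so every \<open>g\<close> is the left component of a morphism from the versor.
\<close>

lemma left_versor_arrow:
  assumes W: "bimodule R S W" and A: "bimap R S W A" and P: "left_module R P"
    and \<iota>: "inj_on \<iota> (lhom R P W)" and g: "g \<in> lhom R P (lmod A)"
  shows "(g, \<lambda>v\<in>carrier (rmod A). \<iota> (\<lambda>x\<in>carrier P. form A (g x) v))
    \<in> Arr (Adj R S W) (left_versor R W \<iota> P) A"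
proof -
  interpret A: bimap R S W A by fact
  interpret P: left_module R P by fact
  have \<iota>': "inj_on \<iota> (carrier (Hom_module R P W))" using \<iota> by (simp add: Hom_module_simps)
  note simps = relabel_simps[OF \<iota>', unfolded Hom_module_simps(1)]
  note g = lhomD[OF g] \<open>g \<in> lhom R P (lmod A)\<close>
  have hom: "(\<lambda>x\<in>carrier P. form A (g x) v) \<in> lhom R P W" if "v \<in> carrier (rmod A)" for v
    using that g by (intro lhomI) (auto simp: A.form_closed A.form_add_left A.form_smult)
  have "(\<lambda>v\<in>carrier (rmod A). \<iota> (\<lambda>x\<in>carrier P. form A (g x) v))
      \<in> rhom S (rmod A) (relabel \<iota> (Hom_module R P W))"
    by (intro rhomI)
      (auto simp: simps hom Hom_module_simps g(1) A.form_add_right A.form_rsmult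
        intro!: arg_cong[of _ _ \<iota>] restrict_ext)
  then show ?thesis
    using g(5) form_left_versor[OF \<iota> hom]
    by (auto simp: Adj_simps left_versor_def)
qed

text \<open>
  Distinct elements of \<open>Hom\<^sub>R(P, W)\<close> differ in some value, so a morphism from the versor is
  determined by its left component.
\<close>

lemma left_versor_arrow_right_component:
  assumes \<iota>: "inj_on \<iota> (lhom R P W)"
    and f: "(f\<^sub>1, f\<^sub>2) \<in> Arr (Adj R S W) (left_versor R W \<iota> P) B"
    and v: "v \<in> carrier (rmod B)"
  shows "f\<^sub>2 v = \<iota> (\<lambda>x\<in>carrier P. form B (f\<^sub>1 x) v)"
proof -
  have "f\<^sub>2 v \<in> \<iota> ` lhom R P W"
    using f v by (auto simp: Adj_simps left_versor_def relabel_def Let_def Hom_module_simps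
        dest!: rhomD(1))
  then obtain \<tau> where \<tau>: "f\<^sub>2 v = \<iota> \<tau>" "\<tau> \<in> lhom R P W" by auto
  have "form B (f\<^sub>1 x) v = \<tau> x" if "x \<in> carrier P" for x
  proof -
    have "form B (f\<^sub>1 x) v = form (left_versor R W \<iota> P) x (f\<^sub>2 v)"
      using f v that by (simp add: Adj_simps left_versor_def)
    then show ?thesis using \<tau> by (simp add: form_left_versor[OF \<iota>])
  qed
  then have "(\<lambda>x\<in>carrier P. form B (f\<^sub>1 x) v) = \<tau>"
    using lhomD(4)[OF \<tau>(2)] by (intro extensionalityI[OF restrict_extensional]) auto
  then show ?thesis using \<tau> by simp
qed

theorem theorem2p33:
  fixes R :: "('r, 'm) ring_scheme" and S :: "('s, 'n) ring_scheme"
    and W :: "('r, 's, 'w) bimodule" and P :: "('r, 'u) module"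
    and \<iota> :: "('u \<Rightarrow> 'w) \<Rightarrow> 'v"
  assumes "ring R" and "ring S" and "bimodule R S W"
    and "projective_module R P"
    and "inj_on \<iota> (lhom R P W)"
  shows "projective_object (Adj R S W) (left_versor R W \<iota> P)"
proof -
  note W = assms(3) and P = assms(4) and \<iota> = assms(5)
  let ?T = "left_versor R W \<iota> P"
  have lP: "left_module R P" using P by (simp add: projective_module_def)
  have lmod_T: "lmod ?T = P" by (simp add: left_versor_def)
  show ?thesis
    unfolding projective_object_def
  proof (intro conjI ballI allI impI)
    show "?T \<in> Obj (Adj R S W)" using bimap_left_versor[OF W lP \<iota>] by (simp add: Adj_simps)
  next
    fix A B :: "('r, 's, 'u, 'v, 'w) bimap" and e f
    assume "A \<in> Obj (Adj R S W)" and "B \<in> Obj (Adj R S W)"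
      and epi: "epimorphism (Adj R S W) A B e" and f: "f \<in> Arr (Adj R S W) ?T B"
    then have A: "bimap R S W A" and B: "bimap R S W B" by (simp_all add: Adj_simps)
    obtain \<mu> \<nu> where e: "e = (\<mu>, \<nu>)" by fastforce
    obtain f\<^sub>1 f\<^sub>2 where f_eq: "f = (f\<^sub>1, f\<^sub>2)" by fastforce
    have \<mu>: "\<mu> \<in> lhom R (lmod A) (lmod B)" and \<nu>: "\<nu> \<in> rhom S (rmod B) (rmod A)"
      and adj: "\<And>u v. u \<in> carrier (lmod A) \<Longrightarrow> v \<in> carrier (rmod B) \<Longrightarrow>
        form B (\<mu> u) v = form A u (\<nu> v)"
      using epi by (auto simp: e epimorphism_def Adj_simps)
    have f\<^sub>1: "f\<^sub>1 \<in> lhom R P (lmod B)" and f\<^sub>2: "f\<^sub>2 \<in> extensional (carrier (rmod B))"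
      using f rhomD(4) by (auto simp: f_eq Adj_simps lmod_T)
    have surj: "\<mu> ` carrier (lmod A) = carrier (lmod B)"
      using epimorphism_Adj_surj[OF W A B epi] by (simp add: e)
    obtain g\<^sub>1 where g\<^sub>1: "g\<^sub>1 \<in> lhom R P (lmod A)" and lift: "compose (carrier P) \<mu> g\<^sub>1 = f\<^sub>1"
      using projective_module_lift[OF P bimap_mods(1)[OF A] bimap_mods(1)[OF B] \<mu> surj f\<^sub>1] by auto
    define g\<^sub>2 where "g\<^sub>2 = (\<lambda>v\<in>carrier (rmod A). \<iota> (\<lambda>x\<in>carrier P. form A (g\<^sub>1 x) v))"
    have g: "(g\<^sub>1, g\<^sub>2) \<in> Arr (Adj R S W) ?T A"
      unfolding g\<^sub>2_def by (rule left_versor_arrow[OF W A lP \<iota> g\<^sub>1])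
    have "compose (carrier (rmod B)) g\<^sub>2 \<nu> = f\<^sub>2"
    proof (rule extensionalityI[OF compose_extensional f\<^sub>2])
      fix v assume v: "v \<in> carrier (rmod B)"
      have "form A (g\<^sub>1 x) (\<nu> v) = form B (f\<^sub>1 x) v" if "x \<in> carrier P" for x
        using adj[OF lhomD(1)[OF g\<^sub>1 that] v] that by (simp add: compose_def flip: lift)
      then have "g\<^sub>2 (\<nu> v) = \<iota> (\<lambda>x\<in>carrier P. form B (f\<^sub>1 x) v)"
        using rhomD(1)[OF \<nu> v] by (auto simp: g\<^sub>2_def intro!: arg_cong[of _ _ \<iota>] restrict_ext)
      also have "\<dots> = f\<^sub>2 v"
        using left_versor_arrow_right_component[OF \<iota> f[unfolded f_eq] v] by simp
      finally show "compose (carrier (rmod B)) g\<^sub>2 \<nu> v = f\<^sub>2 v" using v by (simp add: compose_def)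
    qed
    then have "comp (Adj R S W) ?T A B (g\<^sub>1, g\<^sub>2) e = f"
      by (simp add: Adj_simps lmod_T e f_eq lift)
    then show "\<exists>g\<in>Arr (Adj R S W) ?T A. comp (Adj R S W) ?T A B g e = f"
      using g by blast
  qed
qed

end
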